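(* Let $p$ be a fixed prime. There is a constant $c>0$ (depending only on $p$) such that the following holds. Let $A\subset\mathbb{F}_p(\!(t^{-1})\!)$ be a finite set. If $\xi_1,\xi_2\in\mathbb{F}_p(\!(t^{-1})\!)$ are algebraically independent over $\mathbb{F}_p$ and $K_1,K_2\geq 2$ are such that \[|A+\xi_1A|\leq K_1|A| \quad\text{and}\quad |A+\xi_2A|\leq K_2|A|,\] then \[(\log K_1)(\log K_2)\geq c\log|A|.\]
   Context: $\mathbb{F}_p(\!(t^{-1})\!)=\{\sum_{n=-\infty}^{k}a_nt^n: a_n\in\mathbb{F}_p, k\in\mathbb{Z}\}$ is the field of Laurent series in $t^{-1}$ over $\mathbb{F}_p$. For a set $A$ and element $\xi$, $A+\xi A=\{a+\xi b:a,b\in A\}$. The implicit constant may depend on $p$. *)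

theory Defs
  imports
    "HOL-Computational_Algebra.Formal_Laurent_Series"
    "Berlekamp_Zassenhaus.Finite_Field"
    Complex_Main
begin

text \<open>
  The prime field with \<open>p\<close> elements is \<open>'p mod_ring\<close>, where \<open>'p\<close> ranges over the types of
  prime cardinality \<open>p = CARD('p)\<close>. The variable of \<open>fls\<close> plays the role of the inverse of
  \<open>t\<close>: the series with coefficients \<open>a n\<close> at the powers \<open>t ^ n\<close>, for \<open>n \<le> k\<close>, has its
  coefficient \<open>a n\<close> at the exponent \<open>- n\<close>.
\<close>

type_synonym 'p laurent_inv_t = "'p mod_ring fls"

text \<open>
  Bivariate polynomials over \<open>'a\<close> are univariate polynomials with coefficients in \<open>'a poly\<close>:
  the coefficients involve the first indeterminate, the outer variable is the second one.
\<close>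

definition eval_bivariate :: "'a::field poly poly \<Rightarrow> 'a fls \<Rightarrow> 'a fls \<Rightarrow> 'a fls" where
  "eval_bivariate P x y = poly (map_poly (\<lambda>q. poly (map_poly fls_const q) x) P) y"

definition algebraically_independent :: "'a::field fls \<Rightarrow> 'a fls \<Rightarrow> bool" where
  "algebraically_independent x y \<longleftrightarrow> (\<forall>P. P \<noteq> 0 \<longrightarrow> eval_bivariate P x y \<noteq> 0)"

definition sum_dilate :: "'a::semiring set \<Rightarrow> 'a \<Rightarrow> 'a set" where
  "sum_dilate A \<xi> = {a + \<xi> * b | a b. a \<in> A \<and> b \<in> A}"

end

theory Submission
  imports Defs
begin

text \<open>
  Clearing denominators and substituting \<open>\<xi>\<^sub>1 \<mapsto> z\<close>, \<open>\<xi>\<^sub>2 \<mapsto> z ^ M\<close> (\<open>M\<close> large) turns \<open>A\<close> into a set of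
  polynomials in \<open>z\<close>. Let \<open>g i\<close> be the entropy of the coefficient of index \<open>i\<close> of a uniform
  element of \<open>A\<close>, conditioned on the coefficients of smaller index, so that \<open>ln |A| = \<Sum>i. g i\<close>.
  The chain rule for \<open>A + z ^ s A\<close> bounds \<open>\<Sum>i. G i - g i\<close> by \<open>ln K\<close>, where \<open>G i\<close> is an averaged entropy
  of convolutions. It satisfies \<open>G i \<ge> max (g i) (g (i - s))\<close>, and it is at least
  \<open>3/4 (g i + g (i - s))\<close> up to a bilinear error. Hence \<open>g\<close> has variation at most \<open>2 ln K\<close> in the
  direction \<open>s\<close>, and its small values sum to \<open>O(ln K)\<close>. The indices form a planar grid on which
  \<open>s = 1\<close> and \<open>s = M\<close> are the unit translations, so the large values lie in \<open>O(ln K\<^sub>1)\<close> rows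
  and \<open>O(ln K\<^sub>2)\<close> columns.
\<close>

hide_const (open) up_ring.coeff up_ring.monom module.smult

subsection \<open>Entropy of convolutions\<close>

definition entropy :: "('a::finite \<Rightarrow> real) \<Rightarrow> real" where
  "entropy p = (\<Sum>v\<in>UNIV. - p v * ln (p v))"

definition is_dist :: "('a::finite \<Rightarrow> real) \<Rightarrow> bool" where
  "is_dist p \<longleftrightarrow> (\<forall>v. 0 \<le> p v) \<and> sum p UNIV = 1"

definition conv :: "('a::{finite,ab_group_add} \<Rightarrow> real) \<Rightarrow> ('a \<Rightarrow> real) \<Rightarrow> 'a \<Rightarrow> real" where
  "conv p q w = (\<Sum>v\<in>UNIV. p v * q (w - v))"

lemma is_dist_nonneg: "is_dist p \<Longrightarrow> 0 \<le> p v"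
  by (simp add: is_dist_def)

lemma is_dist_le_1: "is_dist p \<Longrightarrow> p v \<le> 1"
  using member_le_sum[of v UNIV p] by (simp add: is_dist_def)

text \<open>This is \<open>ln z <= z - 1\<close> at \<open>z = y / x\<close>, the form in which the
  tangent bound enters the entropy estimates below.\<close>

lemma mult_ln_diff_le:
  fixes x y :: real
  assumes "0 < x" "0 < y"
  shows "x * (ln y - ln x) \<le> y - x"
proof -
  have "x * ln (y / x) \<le> x * (y / x - 1)"
    using assms by (intro mult_left_mono ln_le_minus_one) auto
  thus ?thesis using assms by (simp add: ln_div right_diff_distrib)
qed

lemma entropy_term_nonneg:
  fixes t :: real
  assumes "0 \<le> t" "t \<le> 1"
  shows "0 \<le> - t * ln t"
  using assms by (cases "t = 0") (auto simp: mult_nonneg_nonpos)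

lemma entropy_nonneg: "is_dist p \<Longrightarrow> 0 \<le> entropy p"
  unfolding entropy_def
  by (intro sum_nonneg entropy_term_nonneg) (auto simp: is_dist_nonneg is_dist_le_1)

text \<open>Nonnegativity of the relative entropy of \<open>p\<close> with respect to
  \<open>N / T\<close>, where \<open>T\<close> is the total weight. When \<open>N\<close> counts the
  points of fibres, it bounds entropies by logarithms of cardinalities.\<close>

lemma gibbs:
  assumes p: "is_dist p" and N: "\<And>v. 0 \<le> N v" and pos: "\<And>v. p v > 0 \<Longrightarrow> N v > 0"
  shows "entropy p + (\<Sum>v\<in>UNIV. p v * ln (N v)) \<le> ln (\<Sum>v\<in>UNIV. N v)"
proof -
  define T where "T = (\<Sum>v\<in>UNIV. N v)"
  obtain v0 where "p v0 > 0"
    using p unfolding is_dist_def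
    by (metis less_eq_real_def sum.neutral zero_neq_one)
  hence "N v0 > 0" by (rule pos)
  hence T: "T > 0" unfolding T_def using N by (meson UNIV_I finite sum_pos2)
  have "p v * ln (N v) - p v * ln (p v) - p v * ln T \<le> N v / T - p v" for v
  proof (cases "p v = 0")
    case True
    then show ?thesis using N T by simp
  next
    case False
    hence pv: "p v > 0" using is_dist_nonneg[OF p, of v] by simp
    show ?thesis
      using mult_ln_diff_le[OF pv, of "N v / T"] pos[OF pv] T by (simp add: ln_div algebra_simps)
  qed
  hence "(\<Sum>v\<in>UNIV. p v * ln (N v) - p v * ln (p v) - p v * ln T) \<le> (\<Sum>v\<in>UNIV. N v / T - p v)"
    by (intro sum_mono) auto
  also have "\<dots> = 0"
    using T p by (simp add: sum_subtractf is_dist_def flip: sum_divide_distrib T_def)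
  finally show ?thesis
    using p unfolding entropy_def is_dist_def T_def[symmetric]
    by (simp add: sum_subtractf sum_negf flip: sum_distrib_right)
qed

lemma entropy_le_ln_card:
  fixes p :: "'a::finite \<Rightarrow> real"
  assumes "is_dist p"
  shows "entropy p \<le> ln (real CARD('a))"
  using gibbs[OF assms, of "\<lambda>_. 1"] by simp

lemma conv_commute: "conv p q = conv q p"
proof
  fix w
  show "conv p q w = conv q p w"
    unfolding conv_def
    by (rule sum.reindex_bij_witness[of _ "\<lambda>v. w - v" "\<lambda>v. w - v"]) auto
qed

lemma sum_conv_mult:
  fixes p q :: "'a::{finite,ab_group_add} \<Rightarrow> real"
  shows "(\<Sum>w\<in>UNIV. conv p q w * f w) = (\<Sum>v\<in>UNIV. \<Sum>u\<in>UNIV. p v * q u * f (v + u))"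
proof -
  have "(\<Sum>w\<in>UNIV. conv p q w * f w) = (\<Sum>v\<in>UNIV. \<Sum>w\<in>UNIV. p v * q (w - v) * f w)"
    unfolding conv_def sum_distrib_right by (rule sum.swap)
  also have "\<dots> = (\<Sum>v\<in>UNIV. \<Sum>u\<in>UNIV. p v * q u * f (v + u))"
  proof (rule sum.cong[OF refl])
    fix v :: 'a
    show "(\<Sum>w\<in>UNIV. p v * q (w - v) * f w) = (\<Sum>u\<in>UNIV. p v * q u * f (v + u))"
      by (rule sum.reindex_bij_witness[of _ "\<lambda>u. v + u" "\<lambda>w. w - v"]) auto
  qed
  finally show ?thesis .
qed

lemma is_dist_conv:
  assumes "is_dist p" "is_dist q"
  shows "is_dist (conv p q)"
proof -
  have "(\<Sum>w\<in>UNIV. conv p q w) = (\<Sum>v\<in>UNIV. \<Sum>u\<in>UNIV. p v * q u)"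
    using sum_conv_mult[of p q "\<lambda>_. 1"] by simp
  also have "\<dots> = 1"
    using assms by (simp add: is_dist_def flip: sum_distrib_left)
  finally show ?thesis
    using assms unfolding is_dist_def conv_def by (auto intro!: sum_nonneg)
qed

text \<open>Given the first summand \<open>v\<close>, the sum is a translate of \<open>q\<close>.
  Gibbs' inequality compares this translate with the law of the sum, whose weights add up to 1, and
  the result is averaged over \<open>v\<close>.\<close>

lemma entropy_le_conv:
  fixes p q :: "'a::{finite,ab_group_add} \<Rightarrow> real"
  assumes p: "is_dist p" and q: "is_dist q"
  shows "entropy q \<le> entropy (conv p q)"
proof -
  let ?r = "conv p q"
  have r: "is_dist ?r" by (rule is_dist_conv[OF p q])
  have rpos: "?r (v + u) > 0" if "p v > 0" "q u > 0" for v u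
  proof -
    have "0 < p v * q (v + u - v)" using that by simp
    also have "\<dots> \<le> ?r (v + u)"
      unfolding conv_def using p q
      by (intro member_le_sum[of _ _ "\<lambda>x. p x * q (v + u - x)"]) (auto simp: is_dist_def)
    finally show ?thesis .
  qed
  have "entropy q + (\<Sum>u\<in>UNIV. q u * ln (?r (v + u))) \<le> 0" if "p v > 0" for v
  proof -
    have "entropy q + (\<Sum>u\<in>UNIV. q u * ln (?r (v + u))) \<le> ln (\<Sum>u\<in>UNIV. ?r (v + u))"
      using that r by (intro gibbs q) (auto simp: is_dist_nonneg intro: rpos)
    also have "(\<Sum>u\<in>UNIV. ?r (v + u)) = (\<Sum>u\<in>UNIV. ?r u)"
      by (rule sum.reindex_bij_witness[of _ "\<lambda>u. u - v" "\<lambda>u. v + u"]) auto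
    finally show ?thesis using r by (simp add: is_dist_def)
  qed
  hence "p v * (entropy q + (\<Sum>u\<in>UNIV. q u * ln (?r (v + u)))) \<le> 0" for v
    using is_dist_nonneg[OF p, of v] by (cases "p v = 0") (auto simp: mult_le_0_iff)
  hence "(\<Sum>v\<in>UNIV. p v * (entropy q + (\<Sum>u\<in>UNIV. q u * ln (?r (v + u))))) \<le> 0"
    by (rule sum_nonpos)
  moreover have "entropy ?r = - (\<Sum>v\<in>UNIV. p v * (\<Sum>u\<in>UNIV. q u * ln (?r (v + u))))"
    unfolding entropy_def using sum_conv_mult[of p q "\<lambda>w. ln (?r w)"]
    by (simp add: sum_negf sum_distrib_left mult.assoc)
  ultimately show ?thesis
    using p by (simp add: distrib_left sum.distrib is_dist_def flip: sum_distrib_right)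
qed

section \<open>Entropy of the convolution of nearly concentrated distributions\<close>

lemma entropy_term_add:
  fixes a b :: real
  assumes "0 \<le> a" "0 \<le> b"
  shows "- a * ln a - b * ln b - (a + b) * ln 2 \<le> - (a + b) * ln (a + b)"
proof (cases "a = 0 \<or> b = 0")
  case True
  then show ?thesis using assms by auto
next
  case False
  hence pos: "a > 0" "b > 0" using assms by auto
  have *: "x * (ln (a + b) - ln 2 - ln x) \<le> (a + b) / 2 - x" if "x > 0" for x
    using mult_ln_diff_le[OF that, of "(a + b) / 2"] pos by (simp add: ln_div)
  show ?thesis using *[OF pos(1)] *[OF pos(2)] by (simp add: algebra_simps)
qed

text \<open>The derivative \<open>- 1 - ln t\<close> of \<open>- t ln t\<close> is nonnegative up to
  \<open>exp (-1)\<close>.\<close>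

lemma entropy_term_mono:
  fixes s t :: real
  assumes "0 \<le> s" "s \<le> t" "t \<le> exp (-1)"
  shows "- s * ln s \<le> - t * ln t"
proof (cases "s = 0")
  case True
  have "t \<le> 1" using assms(3) by (meson exp_le_one_iff le_minus_one_simps(1) order_trans)
  then show ?thesis using True assms entropy_term_nonneg[of t] by simp
next
  case False
  hence pos: "s > 0" "t > 0" using assms by auto
  have "ln t \<le> -1" using assms pos by (metis ln_exp ln_mono)
  have "s * (ln t - ln s) \<le> t - s" by (rule mult_ln_diff_le[OF pos])
  moreover have "(t - s) * (1 + ln t) \<le> 0"
    using assms \<open>ln t \<le> -1\<close> by (intro mult_nonneg_nonpos) auto
  ultimately show ?thesis by (simp add: algebra_simps)
qed

text \<open>Entropy is the mean of \<open>- ln (p v)\<close>, so at the heaviest atom this quantity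
  is at most the mean.\<close>

lemma exists_prob_ge_exp_entropy:
  fixes p :: "'a::finite \<Rightarrow> real"
  assumes p: "is_dist p"
  shows "\<exists>v. exp (- entropy p) \<le> p v"
proof -
  obtain v where v: "\<And>u. p u \<le> p v"
    using finite_imageI[OF finite[of "UNIV :: 'a set"], of p] Max_in[of "range p"] Max_ge[of "range p"]
    by (metis UNIV_not_empty empty_is_image finite_imageI finite imageE rangeI)
  have "p v > 0"
  proof (rule ccontr)
    assume "\<not> ?thesis"
    hence "p u = 0" for u using v[of u] is_dist_nonneg[OF p, of u] by linarith
    thus False using p by (simp add: is_dist_def)
  qed
  have "p u * ln (p u) \<le> p u * ln (p v)" for u
    using v[of u] is_dist_nonneg[OF p, of u] \<open>p v > 0\<close>
    by (cases "p u = 0") (auto intro!: mult_left_mono ln_mono)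
  hence "- entropy p \<le> (\<Sum>u\<in>UNIV. p u * ln (p v))"
    unfolding entropy_def by (simp add: sum_negf sum_mono)
  also have "\<dots> = ln (p v)" using p by (simp add: is_dist_def flip: sum_distrib_right)
  finally show ?thesis using \<open>p v > 0\<close> by (metis exp_le_cancel_iff exp_ln)
qed

lemma entropy_translate:
  fixes p :: "'a::{finite,ab_group_add} \<Rightarrow> real"
  shows "entropy (\<lambda>v. p (v + a)) = entropy p"
  unfolding entropy_def
  by (rule sum.reindex_bij_witness[of _ "\<lambda>u. u - a" "\<lambda>u. u + a"]) auto

lemma is_dist_translate:
  fixes p :: "'a::{finite,ab_group_add} \<Rightarrow> real"
  assumes "is_dist p"
  shows "is_dist (\<lambda>v. p (v + a))"
proof -
  have "(\<Sum>v\<in>UNIV. p (v + a)) = sum p UNIV"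
    by (rule sum.reindex_bij_witness[of _ "\<lambda>u. u - a" "\<lambda>u. u + a"]) auto
  thus ?thesis using assms by (simp add: is_dist_def)
qed

lemma conv_translate:
  fixes p q :: "'a::{finite,ab_group_add} \<Rightarrow> real"
  shows "conv (\<lambda>v. p (v + a)) (\<lambda>v. q (v + b)) = (\<lambda>w. conv p q (w + (a + b)))"
  unfolding conv_def
  by (intro ext sum.reindex_bij_witness[of _ "\<lambda>u. u - a" "\<lambda>u. u + a"]) (auto simp: algebra_simps)

text \<open>
  A distribution with most of its mass at \<open>0\<close> has most of its entropy off \<open>0\<close>, and off \<open>0\<close> the
  convolution is close to the sum of the two densities.
\<close>

lemma off_zero_entropy:
  fixes p :: "'a::{finite,zero} \<Rightarrow> real"
  assumes p: "is_dist p" and d: "1 - p 0 \<le> exp (- 16)"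
  shows "16 * (1 - p 0) \<le> (\<Sum>v\<in>-{0}. - p v * ln (p v))"
    and "entropy p \<le> 17 / 16 * (\<Sum>v\<in>-{0}. - p v * ln (p v))"
proof -
  have split: "sum f UNIV = f 0 + sum f (-{0})" for f :: "'a \<Rightarrow> real"
    by (metis Compl_eq_Diff_UNIV UNIV_I finite sum.remove)
  have eps: "1 - p 0 = (\<Sum>v\<in>-{0}. p v)" using p split[of p] by (simp add: is_dist_def)
  have le: "p v \<le> exp (-16)" if "v \<noteq> 0" for v
  proof -
    have "p v \<le> (\<Sum>v\<in>-{0}. p v)" using that is_dist_nonneg[OF p] by (intro member_le_sum) auto
    thus ?thesis using eps d by simp
  qed
  have "16 * p v \<le> - p v * ln (p v)" if "v \<noteq> 0" for v
  proof (cases "p v = 0")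
    case False
    hence pv: "p v > 0" using is_dist_nonneg[OF p, of v] by simp
    hence "ln (p v) \<le> -16" using le[OF that] by (metis ln_exp ln_mono)
    thus ?thesis using mult_left_mono[of "ln (p v)" "-16" "p v"] pv by simp
  qed simp
  thus 1: "16 * (1 - p 0) \<le> (\<Sum>v\<in>-{0}. - p v * ln (p v))"
    unfolding eps sum_distrib_left by (intro sum_mono) auto
  have p0: "p 0 > 0" using d by (smt (verit) exp_less_one_iff)
  \<comment> \<open>The atom at 0 contributes at most \<open>1 - p 0\<close>, hence by the first
    claim at most a sixteenth of the part off 0.\<close>
  have "- p 0 * ln (p 0) \<le> 1 - p 0" using mult_ln_diff_le[OF p0, of 1] by simp
  moreover have gen: "a \<le> b \<Longrightarrow> 16 * b \<le> S \<Longrightarrow> a + S \<le> 17 / 16 * S" for a b S :: real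
    by argo
  ultimately show "entropy p \<le> 17 / 16 * (\<Sum>v\<in>-{0}. - p v * ln (p v))"
    using 1 gen unfolding entropy_def split by blast
qed

lemma entropy_conv_concentrated:
  fixes p q :: "'a::{finite,ab_group_add} \<Rightarrow> real"
  assumes p: "is_dist p" and q: "is_dist q"
    and p0: "1 - p 0 \<le> exp (- 16)" and q0: "1 - q 0 \<le> exp (- 16)"
  shows "3 / 4 * (entropy p + entropy q) \<le> entropy (conv p q)"
proof -
  let ?r = "conv p q" and ?I = "-{0::'a}"
  let ?\<delta> = "exp (- 16) :: real"
  define hp where "hp = (\<Sum>v\<in>?I. - p v * ln (p v))"
  define hq where "hq = (\<Sum>v\<in>?I. - q v * ln (q v))"
  have r: "is_dist ?r" by (rule is_dist_conv[OF p q])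
  have split: "sum f UNIV = f 0 + sum f ?I" for f :: "'a \<Rightarrow> real"
    by (metis Compl_eq_Diff_UNIV UNIV_I finite sum.remove)
  have d: "?\<delta> \<le> 1 / 17" using exp_ge_add_one_self[of "16::real"]
    by (simp add: exp_minus field_simps)
  have e1: "exp (-1) \<ge> (1/4::real)"
    using exp_le by (simp add: exp_minus field_simps)
  have pn: "0 \<le> p v" and qn: "0 \<le> q v" for v
    using p q by (auto simp: is_dist_def)
  have r0: "p 0 * q 0 \<le> ?r 0"
    unfolding conv_def using member_le_sum[of 0 UNIV "\<lambda>v. p v * q (0 - v)"] pn qn by simp
  have r0': "1 - ?r 0 \<le> 2 * ?\<delta>"
  proof -
    have "(1 - ?\<delta>) * (1 - ?\<delta>) \<le> p 0 * q 0" using p0 q0 d by (intro mult_mono) auto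
    moreover have "(1 - ?\<delta>) * (1 - ?\<delta>) = 1 - 2 * ?\<delta> + ?\<delta> * ?\<delta>" by (simp add: algebra_simps)
    moreover have "0 \<le> ?\<delta> * ?\<delta>" by simp
    ultimately show ?thesis using r0 by linarith
  qed
  have off: "(1 - ?\<delta>) * (- p v * ln (p v) - q v * ln (q v) - (p v + q v) * ln 2) \<le> - ?r v * ln (?r v)"
    if v: "v \<noteq> 0" for v
  proof -
    define s where "s = (1 - ?\<delta>) * (p v + q v)"
    \<comment> \<open>Only two ways to reach \<open>v\<close> are kept: one summand is 0 and the
      other is \<open>v\<close>.\<close>
    have "p v * q 0 + p 0 * q v = (\<Sum>u\<in>{0, v}. p u * q (v - u))" using v by simp
    also have "\<dots> \<le> ?r v" unfolding conv_def using pn qn by (intro sum_mono2) auto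
    finally have *: "p v * q 0 + p 0 * q v \<le> ?r v" .
    have "s \<le> p v * q 0 + p 0 * q v"
    proof -
      have "p v * (1 - ?\<delta>) \<le> p v * q 0" "(1 - ?\<delta>) * q v \<le> p 0 * q v"
        using p0 q0 pn qn by (auto intro!: mult_left_mono mult_right_mono)
      thus ?thesis unfolding s_def by (simp add: algebra_simps)
    qed
    with * have sr: "s \<le> ?r v" by simp
    \<comment> \<open>The mass at \<open>v\<close> is at most \<open>1 - ?r 0 <= 2 / 17\<close>,
      inside the range where \<open>- t ln t\<close> increases.\<close>
    have "?r v \<le> (\<Sum>u\<in>?I. ?r u)" using v is_dist_nonneg[OF r] by (intro member_le_sum) auto
    also have "\<dots> = 1 - ?r 0" using split[of ?r] r by (simp add: is_dist_def)
    finally have rs: "?r v \<le> exp (-1)" using r0' d e1 by linarith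
    have s0: "0 \<le> s" unfolding s_def using pn[of v] qn[of v] d by simp
    \<comment> \<open>Concavity of \<open>- t ln t\<close> at the midpoint: merging masses
      \<open>a\<close> and \<open>b\<close> into one atom loses at most
      \<open>(a + b) * ln 2\<close>.\<close>
    have "(1 - ?\<delta>) * (- p v * ln (p v) - q v * ln (q v) - (p v + q v) * ln 2)
      \<le> (1 - ?\<delta>) * (- (p v + q v) * ln (p v + q v))"
      using d by (intro mult_left_mono entropy_term_add pn qn) auto
    also have "\<dots> = - s * ln (p v + q v)" by (simp add: s_def algebra_simps)
    also have "\<dots> \<le> - s * ln s"
    proof (cases "p v + q v = 0")
      case False
      hence pos: "p v + q v > 0" using pn[of v] qn[of v] by linarith
      hence "s > 0" unfolding s_def using d by simp
      moreover have "s \<le> p v + q v" 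
        using mult_left_le_one_le[of "p v + q v" "1 - ?\<delta>"] pos d unfolding s_def by simp
      ultimately show ?thesis by (simp add: ln_mono)
    qed (simp add: s_def)
    also have "\<dots> \<le> - ?r v * ln (?r v)" by (rule entropy_term_mono[OF s0 sr rs])
    finally show ?thesis .
  qed
  have eq: "1 - p 0 = sum p ?I" "1 - q 0 = sum q ?I"
    using split[of p] split[of q] p q by (auto simp: is_dist_def)
  have "(1 - ?\<delta>) * (hp + hq - ((1 - p 0) + (1 - q 0)) * ln 2)
    = (\<Sum>v\<in>?I. (1 - ?\<delta>) * (- p v * ln (p v) - q v * ln (q v) - (p v + q v) * ln 2))"
    unfolding eq hp_def hq_def
    by (simp add: sum_distrib_left[symmetric] sum_distrib_right[symmetric] sum_subtractf sum.distrib sum_negf distrib_right)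
  also have "\<dots> \<le> (\<Sum>v\<in>?I. - ?r v * ln (?r v))" using off by (intro sum_mono) auto
  also have "\<dots> \<le> entropy ?r"
    unfolding entropy_def split
    using entropy_term_nonneg[OF is_dist_nonneg[OF r] is_dist_le_1[OF r], of 0] by simp
  finally have main: "(1 - ?\<delta>) * (hp + hq - ((1 - p 0) + (1 - q 0)) * ln 2) \<le> entropy ?r" .
  note P = off_zero_entropy[OF p p0, folded hp_def] and Q = off_zero_entropy[OF q q0, folded hq_def]
  have nn: "0 \<le> 1 - p 0" "0 \<le> 1 - q 0" using is_dist_le_1[OF p] is_dist_le_1[OF q] by auto
  have "((1 - p 0) + (1 - q 0)) * ln 2 \<le> ((1 - p 0) + (1 - q 0)) * 1"
    using nn ln_2_less_1 by (intro mult_left_mono) auto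
  hence X: "hp + hq - ((1 - p 0) + (1 - q 0)) * ln 2 \<ge> 15 / 16 * (hp + hq)"
    using P(1) Q(1) by argo
  have hh: "0 \<le> hp + hq" using P(1) Q(1) nn by argo
  \<comment> \<open>The merging loss is at most the mass off 0, a sixteenth of
    \<open>hp + hq\<close>, and \<open>1 - ?\<delta>\<close> is at least \<open>16 / 17\<close>, so
    \<open>15 / 17\<close> remains. Passing from \<open>hp\<close> and \<open>hq\<close> to the full
    entropies costs another \<open>16 / 17\<close>, and \<open>240 / 289\<close> exceeds
    \<open>3 / 4\<close>.\<close>
  have "16 / 17 * (15 / 16 * (hp + hq)) \<le> (1 - ?\<delta>) * (hp + hq - ((1 - p 0) + (1 - q 0)) * ln 2)"
    using X d hh by (intro mult_mono) auto
  with main have "15 / 17 * (hp + hq) \<le> entropy ?r" by simp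
  thus ?thesis using P(2) Q(2) hh by argo
qed

text \<open>If one entropy exceeds \<open>exp (-16)\<close>, the error term absorbs the other one
  and \<open>entropy_le_conv\<close> suffices. Otherwise both heaviest atoms have mass at least
  \<open>1 - exp (-16)\<close>, and translations move them to 0. The bilinear error replaces a case
  distinction because it survives averaging over independent slices.\<close>

lemma entropy_conv_ge:
  fixes p q :: "'a::{finite,ab_group_add} \<Rightarrow> real"
  assumes p: "is_dist p" and q: "is_dist q"
  shows "3 / 4 * (entropy p + entropy q) - exp 16 * entropy p * entropy q \<le> entropy (conv p q)"
proof -
  note np = entropy_nonneg[OF p] and nq = entropy_nonneg[OF q]
  have gq: "entropy q \<le> entropy (conv p q)" by (rule entropy_le_conv[OF p q])
  have gp: "entropy p \<le> entropy (conv p q)"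
    using entropy_le_conv[OF q p] by (simp add: conv_commute)
  consider "entropy p > exp (-16)" | "entropy q > exp (-16)"
    | "entropy p \<le> exp (-16)" "entropy q \<le> exp (-16)" by linarith
  thus ?thesis
  proof cases
    case 1
    hence "1 \<le> exp 16 * entropy p"
      using mult_left_mono[of "exp (-16)" "entropy p" "exp 16"] by (simp flip: exp_add)
    hence "1 * entropy q \<le> exp 16 * entropy p * entropy q" using nq by (rule mult_right_mono)
    thus ?thesis using gp np nq by argo
  next
    case 2
    hence "1 \<le> exp 16 * entropy q"
      using mult_left_mono[of "exp (-16)" "entropy q" "exp 16"] by (simp flip: exp_add)
    hence "1 * entropy p \<le> exp 16 * entropy q * entropy p" using np by (rule mult_right_mono)
    thus ?thesis using gq np nq by (simp add: mult_ac) argo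
  next
    case 3
    obtain a where a: "exp (- entropy p) \<le> p a" using exists_prob_ge_exp_entropy[OF p] by blast
    obtain b where b: "exp (- entropy q) \<le> q b" using exists_prob_ge_exp_entropy[OF q] by blast
    have "1 - p a \<le> exp (-16)" "1 - q b \<le> exp (-16)"
      using a b 3 exp_ge_add_one_self[of "- entropy p"] exp_ge_add_one_self[of "- entropy q"] by linarith+
    hence "3 / 4 * (entropy (\<lambda>v. p (v + a)) + entropy (\<lambda>v. q (v + b)))
      \<le> entropy (conv (\<lambda>v. p (v + a)) (\<lambda>v. q (v + b)))"
      by (intro entropy_conv_concentrated is_dist_translate p q) auto
    hence "3 / 4 * (entropy p + entropy q) \<le> entropy (conv p q)"
      by (simp add: entropy_translate conv_translate)
    moreover have "0 \<le> exp 16 * entropy p * entropy q" using np nq by simp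
    ultimately show ?thesis by linarith
  qed
qed

subsection \<open>Entropy of coefficients\<close>

definition slice :: "'a::zero poly set \<Rightarrow> 'a \<Rightarrow> 'a poly set" where
  "slice A v = {f. pCons v f \<in> A}"

definition branch :: "'a::zero poly set \<Rightarrow> 'a \<Rightarrow> real" where
  "branch A v = real (card (slice A v)) / real (card A)"

definition sumset :: "'a::plus set \<Rightarrow> 'a set \<Rightarrow> 'a set" where
  "sumset A B = {a + b | a b. a \<in> A \<and> b \<in> B}"

text \<open>
  For \<open>f\<close> uniform on \<open>A\<close>, this is the conditional entropy of the coefficient of index \<open>i\<close>
  given the coefficients of smaller index.
\<close>

primrec level_entropy :: "nat \<Rightarrow> 'a::{finite,zero} poly set \<Rightarrow> real" where
  "level_entropy 0 A = entropy (branch A)"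
| "level_entropy (Suc i) A = (\<Sum>v\<in>UNIV. branch A v * level_entropy i (slice A v))"

text \<open>For independent uniform \<open>f\<close> in \<open>A\<close> and \<open>g\<close> in
  \<open>B\<close>, this is the conditional entropy of the coefficient of index \<open>i\<close> of
  \<open>f + g\<close>, given all lower coefficients of both \<open>f\<close> and \<open>g\<close>.
  Conditioning on both keeps the two independent at every step.\<close>

primrec level_conv :: "nat \<Rightarrow> 'a::{finite,comm_ring_1} poly set \<Rightarrow> 'a poly set \<Rightarrow> real" where
  "level_conv 0 A B = entropy (conv (branch A) (branch B))"
| "level_conv (Suc i) A B =
    (\<Sum>v\<in>UNIV. \<Sum>u\<in>UNIV. branch A v * branch B u * level_conv i (slice A v) (slice B u))"

lemma finite_sumset: "finite A \<Longrightarrow> finite B \<Longrightarrow> finite (sumset A B)"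
  unfolding sumset_def using finite_image_set2[of "\<lambda>a. a \<in> A" "\<lambda>b. b \<in> B"] by simp

lemma finite_slice: "finite A \<Longrightarrow> finite (slice A v)"
proof -
  have "slice A v = pCons v -` A" by (auto simp: slice_def)
  thus "finite A \<Longrightarrow> ?thesis" by (simp add: finite_vimageI inj_on_def)
qed

lemma card_eq_sum_slice:
  fixes A :: "'a::{finite,zero} poly set"
  assumes "finite A"
  shows "card A = (\<Sum>v\<in>UNIV. card (slice A v))"
proof -
  have "A = (\<Union>v. pCons v ` slice A v)"
    unfolding slice_def by (auto, metis mem_Collect_eq image_eqI pCons_cases)
  also have "card \<dots> = (\<Sum>v\<in>UNIV. card (pCons v ` slice A v))"
    by (rule card_UN_disjoint) (use assms in \<open>auto simp: finite_slice\<close>)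
  also have "\<dots> = (\<Sum>v\<in>UNIV. card (slice A v))"
    by (intro sum.cong refl card_image) (auto simp: inj_on_def)
  finally show ?thesis .
qed

lemma branch_nonneg: "0 \<le> branch A v"
  by (simp add: branch_def)

lemma is_dist_branch:
  fixes A :: "'a::{finite,zero} poly set"
  assumes "finite A" "A \<noteq> {}"
  shows "is_dist (branch A)"
proof -
  have "card A > 0" using assms by (simp add: card_gt_0_iff)
  moreover have "(\<Sum>v\<in>UNIV. branch A v) = real (card A) / real (card A)"
    using card_eq_sum_slice[OF assms(1)] by (simp add: branch_def flip: sum_divide_distrib of_nat_sum)
  ultimately show ?thesis by (simp add: is_dist_def branch_nonneg)
qed

text \<open>Empty slices, which have no uniform element, carry weight 0. The inductions below
  therefore apply their hypothesis to nonempty slices only.\<close>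

lemma branch_cases:
  assumes "finite A"
  obtains "branch A v = 0" | "branch A v > 0" "slice A v \<noteq> {}" "finite (slice A v)"
proof (cases "slice A v = {}")
  case True
  thus ?thesis using that(1) by (simp add: branch_def)
next
  case False
  hence "A \<noteq> {}" by (auto simp: slice_def)
  hence "branch A v > 0"
    using False assms finite_slice[OF assms, of v] by (simp add: branch_def card_gt_0_iff)
  thus ?thesis using that(2) False finite_slice[OF assms] by blast
qed

lemma coeff_slice_eq_0:
  assumes "\<And>f i. f \<in> A \<Longrightarrow> Suc n \<le> i \<Longrightarrow> coeff f i = 0" "f \<in> slice A v" "n \<le> i"
  shows "coeff f i = 0"
  using assms(1)[of "pCons v f" "Suc i"] assms(2,3) by (simp add: slice_def)

lemma only_zero_poly:
  assumes "\<And>f i. f \<in> A \<Longrightarrow> coeff f i = 0" "A \<noteq> {}"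
  shows "A = {0}"
proof -
  have "f = 0" if "f \<in> A" for f using assms(1)[OF that] by (simp add: poly_eq_iff)
  thus ?thesis using assms(2) by auto
qed

text \<open>Chain rule for the entropy of a uniform element: the constant term is split off, and the
  rest is uniform on a slice.\<close>

lemma ln_card_eq_sum_level_entropy:
  fixes A :: "'a::{finite,zero} poly set"
  assumes "finite A" "A \<noteq> {}" "\<And>f i. f \<in> A \<Longrightarrow> n \<le> i \<Longrightarrow> coeff f i = 0"
  shows "ln (card A) = (\<Sum>i<n. level_entropy i A)"
  using assms
proof (induction n arbitrary: A)
  case 0
  then show ?case using only_zero_poly[of A] by simp
next
  case (Suc n)
  have cA: "card A > 0" using Suc.prems by (simp add: card_gt_0_iff)
  have dist: "is_dist (branch A)" using Suc.prems by (intro is_dist_branch)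
  \<comment> \<open>A nonempty slice has \<open>branch A v * card A\<close> elements. The term with
    \<open>ln (branch A v)\<close> will cancel against \<open>entropy (branch A)\<close>.\<close>
  have *: "branch A v * (\<Sum>i<n. level_entropy i (slice A v))
    = branch A v * ln (branch A v) + branch A v * ln (card A)" for v
  proof (rule branch_cases[OF Suc.prems(1), of v])
    assume v: "branch A v > 0" "slice A v \<noteq> {}" "finite (slice A v)"
    have "ln (card (slice A v)) = (\<Sum>i<n. level_entropy i (slice A v))"
      using v(2,3) coeff_slice_eq_0[OF Suc.prems(3)] by (intro Suc.IH) auto
    moreover have "real (card (slice A v)) = branch A v * card A" using cA by (simp add: branch_def)
    ultimately have "(\<Sum>i<n. level_entropy i (slice A v)) = ln (branch A v) + ln (card A)"
      using v cA by (simp add: ln_mult)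
    thus ?thesis by (simp only: distrib_left)
  qed simp
  have "(\<Sum>i<Suc n. level_entropy i A)
    = entropy (branch A) + (\<Sum>i<n. \<Sum>v\<in>UNIV. branch A v * level_entropy i (slice A v))"
    by (simp add: sum.lessThan_Suc_shift del: sum.lessThan_Suc)
  also have "(\<Sum>i<n. \<Sum>v\<in>UNIV. branch A v * level_entropy i (slice A v))
    = (\<Sum>v\<in>UNIV. branch A v * (\<Sum>i<n. level_entropy i (slice A v)))"
    by (subst sum.swap) (simp add: sum_distrib_left)
  also have "\<dots> = (\<Sum>v\<in>UNIV. branch A v * ln (branch A v)) + ln (card A)"
    using dist by (simp add: * sum.distrib is_dist_def flip: sum_distrib_right)
  finally show ?case by (simp add: entropy_def sum_negf)
qed

text \<open>The law of the sum of independent uniform elements lives on the sumset, which bounds its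
  entropy; conditioning on both summands only lowers the left side. In the induction this becomes
  Gibbs' inequality with weights counting the slices of the sumset.\<close>

lemma sum_level_conv_le_ln_card_sumset:
  fixes A B :: "'a::{finite,comm_ring_1} poly set"
  assumes "finite A" "A \<noteq> {}" "\<And>f i. f \<in> A \<Longrightarrow> n \<le> i \<Longrightarrow> coeff f i = 0"
    and "finite B" "B \<noteq> {}" "\<And>f i. f \<in> B \<Longrightarrow> n \<le> i \<Longrightarrow> coeff f i = 0"
  shows "(\<Sum>i<n. level_conv i A B) \<le> ln (card (sumset A B))"
  using assms
proof (induction n arbitrary: A B)
  case 0
  then have "A = {0}" "B = {0}" using only_zero_poly[of A] only_zero_poly[of B] by auto
  then show ?case by (simp add: sumset_def)
next
  case (Suc n)
  define S where "S = sumset A B"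
  define N where "N w = real (card (slice S w))" for w
  have fS: "finite S" unfolding S_def by (intro finite_sumset Suc.prems)
  have dist: "is_dist (branch A)" "is_dist (branch B)" using Suc.prems by (auto intro!: is_dist_branch)
  \<comment> \<open>Polynomial addition has no carries, so the tails add up inside a single
    slice.\<close>
  have sub: "sumset (slice A v) (slice B u) \<subseteq> slice S (v + u)" for v u
    unfolding sumset_def slice_def S_def by (force simp flip: add_pCons)
  have step: "branch A v * branch B u * (\<Sum>i<n. level_conv i (slice A v) (slice B u))
     \<le> branch A v * branch B u * ln (N (v + u))" for v u
  proof (rule branch_cases[OF Suc.prems(1), of v]; rule branch_cases[OF Suc.prems(4), of u])
    assume v: "branch A v > 0" "slice A v \<noteq> {}" "finite (slice A v)"
      and u: "branch B u > 0" "slice B u \<noteq> {}" "finite (slice B u)"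
    have ne: "sumset (slice A v) (slice B u) \<noteq> {}" using v u by (auto simp: sumset_def)
    have "(\<Sum>i<n. level_conv i (slice A v) (slice B u)) \<le> ln (card (sumset (slice A v) (slice B u)))"
      using v u coeff_slice_eq_0[OF Suc.prems(3)] coeff_slice_eq_0[OF Suc.prems(6)]
      by (intro Suc.IH) auto
    also have "\<dots> \<le> ln (N (v + u))"
      unfolding N_def using sub[of v u] ne fS v u
      by (intro ln_mono) (auto simp: card_gt_0_iff finite_slice finite_sumset intro!: card_mono)
    finally show ?thesis using v u by (intro mult_left_mono) auto
  qed auto
  have N_pos: "N w > 0" if "conv (branch A) (branch B) w > 0" for w
  proof -
    have "(\<Sum>v\<in>UNIV. branch A v * branch B (w - v)) \<noteq> 0" using that by (simp add: conv_def)
    then obtain v where "branch A v * branch B (w - v) \<noteq> 0"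
      by (rule sum.not_neutral_contains_not_neutral)
    hence "slice A v \<noteq> {}" "slice B (w - v) \<noteq> {}" by (auto simp: branch_def)
    hence "sumset (slice A v) (slice B (w - v)) \<noteq> {}" by (auto simp: sumset_def)
    hence "slice S w \<noteq> {}" using sub[of v "w - v"] by auto
    thus ?thesis unfolding N_def using fS by (simp add: card_gt_0_iff finite_slice)
  qed
  have "(\<Sum>i<Suc n. level_conv i A B) = entropy (conv (branch A) (branch B))
    + (\<Sum>i<n. \<Sum>v\<in>UNIV. \<Sum>u\<in>UNIV. branch A v * branch B u * level_conv i (slice A v) (slice B u))"
    by (simp add: sum.lessThan_Suc_shift del: sum.lessThan_Suc)
  also have "(\<Sum>i<n. \<Sum>v\<in>UNIV. \<Sum>u\<in>UNIV. branch A v * branch B u * level_conv i (slice A v) (slice B u))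
    = (\<Sum>v\<in>UNIV. \<Sum>u\<in>UNIV. branch A v * branch B u * (\<Sum>i<n. level_conv i (slice A v) (slice B u)))"
    unfolding sum_distrib_left
    by (subst sum.swap, rule sum.cong[OF refl], rule sum.swap)
  also have "\<dots> \<le> (\<Sum>v\<in>UNIV. \<Sum>u\<in>UNIV. branch A v * branch B u * ln (N (v + u)))"
    by (intro sum_mono step)
  also have "\<dots> = (\<Sum>w\<in>UNIV. conv (branch A) (branch B) w * ln (N w))"
    by (rule sum_conv_mult[symmetric])
  also have "entropy (conv (branch A) (branch B)) + \<dots> \<le> ln (\<Sum>w\<in>UNIV. N w)"
    by (intro gibbs is_dist_conv dist N_pos) (auto simp: N_def)
  also have "(\<Sum>w\<in>UNIV. N w) = card S" unfolding N_def card_eq_sum_slice[OF fS] by simp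
  finally show ?case by (simp add: S_def)
qed

lemma level_entropy_nonneg: "finite A \<Longrightarrow> A \<noteq> {} \<Longrightarrow> 0 \<le> level_entropy i A"
proof (induction i arbitrary: A)
  case 0
  then show ?case by (simp add: entropy_nonneg is_dist_branch)
next
  case (Suc i)
  have "0 \<le> branch A v * level_entropy i (slice A v)" for v
    by (rule branch_cases[OF Suc.prems(1), of v]) (auto simp: Suc.IH)
  thus ?case by (simp add: sum_nonneg)
qed

lemma level_entropy_le:
  fixes A :: "'a::{finite,zero} poly set"
  assumes "finite A" "A \<noteq> {}"
  shows "level_entropy i A \<le> ln (real CARD('a))"
  using assms
proof (induction i arbitrary: A)
  case 0
  then show ?case by (simp add: entropy_le_ln_card is_dist_branch)
next
  case (Suc i)
  have "branch A v * level_entropy i (slice A v) \<le> branch A v * ln (real CARD('a))" for v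
    by (rule branch_cases[OF Suc.prems(1), of v]) (auto simp: Suc.IH)
  hence "level_entropy (Suc i) A \<le> (\<Sum>v\<in>UNIV. branch A v * ln (real CARD('a)))"
    by (simp add: sum_mono)
  also have "\<dots> = ln (real CARD('a))"
    using is_dist_branch[OF Suc.prems] by (simp add: is_dist_def flip: sum_distrib_right)
  finally show ?case .
qed

text \<open>The mean of a product of independent quantities is the product of the means, so a
  bilinear expression keeps its shape when averaged.\<close>

lemma sum_dist_bilinear:
  assumes "is_dist p" "is_dist q"
  shows "(\<Sum>v\<in>UNIV. \<Sum>u\<in>UNIV. p v * q u * (c * (a v + b u) - d * a v * b u))
    = c * ((\<Sum>v\<in>UNIV. p v * a v) + (\<Sum>u\<in>UNIV. q u * b u))
      - d * (\<Sum>v\<in>UNIV. p v * a v) * (\<Sum>u\<in>UNIV. q u * b u)"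
proof -
  let ?P = "\<Sum>v\<in>UNIV. p v * a v" and ?Q = "\<Sum>u\<in>UNIV. q u * b u"
  have "(\<Sum>v\<in>UNIV. \<Sum>u\<in>UNIV. p v * q u * (c * (a v + b u) - d * a v * b u))
    = (\<Sum>v\<in>UNIV. \<Sum>u\<in>UNIV. c * (p v * a v) * q u + c * p v * (q u * b u) - d * (p v * a v) * (q u * b u))"
    by (intro sum.cong refl) (simp add: algebra_simps)
  also have "\<dots> = (\<Sum>v\<in>UNIV. c * (p v * a v) + c * p v * ?Q - d * (p v * a v) * ?Q)"
    using assms(2) by (simp add: sum.distrib sum_subtractf is_dist_def flip: sum_distrib_left)
  also have "\<dots> = c * ?P + c * ?Q - d * ?P * ?Q"
    using assms(1) by (simp add: sum.distrib sum_subtractf is_dist_def flip: sum_distrib_left sum_distrib_right)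
  finally show ?thesis by (simp add: distrib_left)
qed

text \<open>For \<open>i = 0\<close> these are the bounds for convolutions. Each lower bound is at
  most bilinear in the two level entropies, so averaging over independent pairs of slices preserves
  it.\<close>

lemma level_conv_ge:
  fixes A B :: "'a::{finite,comm_ring_1} poly set"
  assumes "finite A" "A \<noteq> {}" "finite B" "B \<noteq> {}"
  shows "level_entropy i A \<le> level_conv i A B"
    and "level_entropy i B \<le> level_conv i A B"
    and "3 / 4 * (level_entropy i A + level_entropy i B) - exp 16 * level_entropy i A * level_entropy i B
      \<le> level_conv i A B"
proof -
  have "level_entropy i A \<le> level_conv i A B \<and> level_entropy i B \<le> level_conv i A B \<and>
    3 / 4 * (level_entropy i A + level_entropy i B) - exp 16 * level_entropy i A * level_entropy i B
      \<le> level_conv i A B"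
    using assms
  proof (induction i arbitrary: A B)
    case 0
    hence "is_dist (branch A)" "is_dist (branch B)" by (auto intro!: is_dist_branch)
    thus ?case
      unfolding level_entropy.simps level_conv.simps
      using entropy_le_conv entropy_conv_ge conv_commute by metis
  next
    case (Suc i)
    let ?p = "branch A" and ?q = "branch B"
    let ?a = "\<lambda>v. level_entropy i (slice A v)" and ?b = "\<lambda>u. level_entropy i (slice B u)"
    have p: "is_dist ?p" and q: "is_dist ?q" using Suc.prems by (auto intro!: is_dist_branch)
    have *: "?p v * ?q u * X v u \<le> ?p v * ?q u * level_conv i (slice A v) (slice B u)"
      if "\<And>v u. slice A v \<noteq> {} \<Longrightarrow> finite (slice A v) \<Longrightarrow> slice B u \<noteq> {} \<Longrightarrow> finite (slice B u) \<Longrightarrow>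
        X v u \<le> level_conv i (slice A v) (slice B u)" for X v u
      by (rule branch_cases[OF Suc.prems(1), of v]; rule branch_cases[OF Suc.prems(3), of u])
        (auto intro!: mult_left_mono that)
    have le: "(\<Sum>v\<in>UNIV. \<Sum>u\<in>UNIV. ?p v * ?q u * X v u) \<le> level_conv (Suc i) A B"
      if "\<And>v u. slice A v \<noteq> {} \<Longrightarrow> finite (slice A v) \<Longrightarrow> slice B u \<noteq> {} \<Longrightarrow> finite (slice B u) \<Longrightarrow>
        X v u \<le> level_conv i (slice A v) (slice B u)" for X
      unfolding level_conv.simps by (intro sum_mono *) (rule that)
    \<comment> \<open>Taking \<open>c = 1\<close>, \<open>d = 0\<close> and one zero function turns
      the bilinear average into a one-sided one.\<close>
    have 1: "level_entropy (Suc i) A \<le> level_conv (Suc i) A B"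
      using le[of "\<lambda>v u. ?a v"] Suc.IH sum_dist_bilinear[OF p q, of 1 ?a "\<lambda>_. 0" 0] by simp
    have 2: "level_entropy (Suc i) B \<le> level_conv (Suc i) A B"
      using le[of "\<lambda>v u. ?b u"] Suc.IH sum_dist_bilinear[OF p q, of 1 "\<lambda>_. 0" ?b 0] by simp
    have 3: "(\<Sum>v\<in>UNIV. \<Sum>u\<in>UNIV. ?p v * ?q u * (3 / 4 * (?a v + ?b u) - exp 16 * ?a v * ?b u))
      \<le> level_conv (Suc i) A B"
      using Suc.IH by (intro le) blast
    show ?case using 1 2 3 unfolding sum_dist_bilinear[OF p q] by simp
  qed
  thus "level_entropy i A \<le> level_conv i A B" "level_entropy i B \<le> level_conv i A B"
    "3 / 4 * (level_entropy i A + level_entropy i B) - exp 16 * level_entropy i A * level_entropy i B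
      \<le> level_conv i A B" by auto
qed

lemma level_entropy_eq_0:
  fixes A :: "'a::{finite,zero} poly set"
  assumes "finite A" "A \<noteq> {}" "\<And>f. f \<in> A \<Longrightarrow> coeff f i = 0"
  shows "level_entropy i A = 0"
  using assms
proof (induction i arbitrary: A)
  case 0
  have "slice A v = {}" if "v \<noteq> 0" for v
    using 0(3)[of "pCons v _"] that by (auto simp: slice_def)
  hence *: "branch A v = 0" if "v \<noteq> 0" for v using that by (simp add: branch_def)
  have "sum (branch A) UNIV = branch A 0 + sum (branch A) (-{0})"
    by (metis Compl_eq_Diff_UNIV UNIV_I finite sum.remove)
  hence "branch A 0 = 1" using is_dist_branch[OF 0(1,2)] * by (simp add: is_dist_def)
  hence "- branch A v * ln (branch A v) = 0" for v using *[of v] by (cases "v = 0") auto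
  thus ?case unfolding level_entropy.simps entropy_def by (intro sum.neutral) auto
next
  case (Suc i)
  have "branch A v * level_entropy i (slice A v) = 0" for v
  proof (rule branch_cases[OF Suc.prems(1), of v])
    assume "slice A v \<noteq> {}" "finite (slice A v)"
    moreover have "coeff f i = 0" if "f \<in> slice A v" for f
      using Suc.prems(3)[of "pCons v f"] that by (simp add: slice_def)
    ultimately show ?thesis by (simp add: Suc.IH)
  qed simp
  thus ?case unfolding level_entropy.simps by (intro sum.neutral) blast
qed

lemma level_entropy_pCons:
  fixes A :: "'a::{finite,zero} poly set"
  assumes "finite A" "A \<noteq> {}"
  shows "level_entropy (Suc i) (pCons 0 ` A) = level_entropy i A"
proof -
  have s: "slice (pCons 0 ` A) v = (if v = 0 then A else {})" for v
    by (auto simp: slice_def)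
  have "card A > 0" using assms by (simp add: card_gt_0_iff)
  moreover have "card (pCons 0 ` A) = card A" by (intro card_image) (auto simp: inj_on_def)
  ultimately have b: "branch (pCons 0 ` A) v = (if v = 0 then 1 else 0)" for v
    by (simp add: branch_def s)
  have "level_entropy (Suc i) (pCons 0 ` A) = (\<Sum>v\<in>(UNIV :: 'a set). if v = 0 then level_entropy i A else 0)"
    unfolding level_entropy.simps by (intro sum.cong) (auto simp: b s)
  thus ?thesis by simp
qed

lemma level_entropy_shift:
  fixes A :: "'a::{finite,comm_ring_1} poly set"
  assumes "finite A" "A \<noteq> {}"
  shows "level_entropy i ((*) (monom 1 s) ` A) = (if i < s then 0 else level_entropy (i - s) A)"
proof (induction s arbitrary: i)
  case 0
  then show ?case by simp
next
  case (Suc s)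
  have *: "(*) (monom 1 (Suc s)) ` A = pCons 0 ` ((*) (monom 1 s) ` A)"
    by (simp add: image_image monom_Suc)
  show ?case
  proof (cases i)
    case 0
    show ?thesis unfolding * 0 using assms by (subst level_entropy_eq_0) auto
  next
    case (Suc j)
    thus ?thesis unfolding * using Suc.IH[of j] assms
      by (simp add: level_entropy_pCons del: level_entropy.simps)
  qed
qed

section \<open>Entropy gain in the sum with a shifted copy\<close>

locale small_dilate =
  fixes A :: "'a::{finite,idom} poly set" and s n :: nat and K :: real
  assumes fin: "finite A" and ne: "A \<noteq> {}"
    and deg: "\<And>f i. f \<in> A \<Longrightarrow> n \<le> i \<Longrightarrow> coeff f i = 0"
    and small: "card (sumset A ((*) (monom 1 s) ` A)) \<le> K * card A"
begin

abbreviation "g i \<equiv> level_entropy i A"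
text \<open>By \<open>level_entropy_shift\<close> these are the level entropies of the copy of
  \<open>A\<close> multiplied by \<open>monom 1 s\<close>. The gain at \<open>i\<close> is
  \<open>2 * G i - g i - g' i\<close>.\<close>

abbreviation "g' i \<equiv> (if i < s then 0 else level_entropy (i - s) A)"
abbreviation "G i \<equiv> level_conv i A ((*) (monom 1 s) ` A)"

text \<open>\<open>G\<close> sums to at most \<open>ln (K * card A)\<close>, while \<open>g\<close>
  and \<open>g'\<close> both sum to \<open>ln (card A)\<close> because shifting is injective. The
  range \<open>n + s\<close> covers all coefficients of the shifted copy.\<close>

lemma gain_sum: "(\<Sum>i<n+s. 2 * G i - g i - g' i) \<le> 2 * ln K"
proof -
  let ?B = "(*) (monom 1 s) ` A"
  have deg': "coeff f i = 0" if "f \<in> ?B" "n + s \<le> i" for f i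
    using that deg by (auto simp: coeff_monom_mult)
  have cA: "card A > 0" using fin ne by (simp add: card_gt_0_iff)
  have cB: "card ?B = card A" by (intro card_image) (auto simp: inj_on_def monom_eq_0_iff)
  have "sumset A ?B \<noteq> {}" using ne by (auto simp: sumset_def)
  hence cS: "card (sumset A ?B) > 0" using fin by (simp add: card_gt_0_iff finite_sumset)
  hence K: "K > 0" using small cA by (smt (verit) mult_nonpos_nonneg of_nat_0_less_iff of_nat_0_le_iff)
  have "(\<Sum>i<n+s. G i) \<le> ln (card (sumset A ?B))"
    using fin ne deg deg' by (intro sum_level_conv_le_ln_card_sumset) auto
  also have "\<dots> \<le> ln (K * card A)" using small cS by (intro ln_mono) auto
  also have "\<dots> = ln K + ln (card A)" using K cA by (simp add: ln_mult)
  finally have 1: "(\<Sum>i<n+s. G i) \<le> ln K + ln (card A)" .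
  have 2: "ln (card A) = (\<Sum>i<n+s. g i)"
    using fin ne deg by (intro ln_card_eq_sum_level_entropy) auto
  have 3: "ln (card A) = (\<Sum>i<n+s. g' i)"
    using fin ne deg' ln_card_eq_sum_level_entropy[of ?B "n + s"]
    by (simp add: cB level_entropy_shift)
  show ?thesis using 1 2 3 by (simp add: sum_subtractf flip: sum_distrib_left)
qed

text \<open>\<open>G i\<close> dominates \<open>g i\<close> and \<open>g' i\<close>, and twice a
  maximum minus the sum is the absolute difference.\<close>

lemma variation: "\<bar>g i - g' i\<bar> \<le> 2 * G i - g i - g' i"
  using level_conv_ge(1,2)[of A "(*) (monom 1 s) ` A" i] fin ne by (auto simp: level_entropy_shift)

lemma sum_variation: "(\<Sum>i<n+s. \<bar>g i - g' i\<bar>) \<le> 2 * ln K"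
  using sum_mono[of "{..<n+s}", OF variation] gain_sum by (rule order_trans)

text \<open>A small level is at most four times its gain. If \<open>g' i\<close> is small too, the
  bilinear error is at most \<open>g i / 8\<close>, and the factor \<open>3 / 4\<close> leaves a
  gain of at least \<open>g i / 4\<close>. If not, \<open>g' i\<close> exceeds
  \<open>2 * g i\<close>, and the variation alone exceeds \<open>g i\<close>.\<close>

lemma sum_small_levels:
  assumes "I \<subseteq> {..<n+s}" "\<And>i. i \<in> I \<Longrightarrow> g i \<le> exp (-16) / 16"
  shows "(\<Sum>i\<in>I. g i) \<le> 8 * ln K"
proof -
  have "g i \<le> 4 * (2 * G i - g i - g' i)" if "i \<in> I" for i
  proof (cases "g' i \<le> exp (-16) / 8")
    case True
    have n: "0 \<le> g i" "0 \<le> g' i" using fin ne by (auto simp: level_entropy_nonneg)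
    have "3 / 4 * (g i + g' i) - exp 16 * g i * g' i \<le> G i"
      using level_conv_ge(3)[of A "(*) (monom 1 s) ` A" i] fin ne by (simp add: level_entropy_shift)
    moreover have "exp 16 * g i * g' i \<le> exp 16 * g i * (exp (-16) / 8)"
      using True n by (intro mult_left_mono) auto
    moreover have "exp 16 * g i * (exp (-16) / 8) = g i / 8"
      by (simp add: exp_minus)
    ultimately show ?thesis using n by argo
  next
    case False
    thus ?thesis using variation[of i] assms(2)[OF that] by argo
  qed
  hence "(\<Sum>i\<in>I. g i) \<le> (\<Sum>i\<in>I. 4 * (2 * G i - g i - g' i))" by (intro sum_mono)
  also have "\<dots> \<le> (\<Sum>i<n+s. 4 * (2 * G i - g i - g' i))"
  proof (intro sum_mono2 assms)
    fix i show "0 \<le> 4 * (2 * G i - g i - g' i)" using variation[of i] by argo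
  qed simp
  also have "\<dots> = 4 * (\<Sum>i<n+s. 2 * G i - g i - g' i)" by (rule sum_distrib_left[symmetric])
  also have "\<dots> \<le> 4 * (2 * ln K)" using gain_sum by (rule mult_left_mono) simp
  finally show ?thesis by simp
qed

end

subsection \<open>Counting on the grid\<close>

context small_dilate
begin

text \<open>Telescoping in steps of \<open>s\<close>: for \<open>j > 0\<close>,
  \<open>g' (b + s * j)\<close> is the previous value \<open>g (b + s * (j - 1))\<close>, and the
  chain starts from 0.\<close>

lemma sum_increments:
  assumes "s > 0" "g' b = 0"
  shows "(\<Sum>j\<le>k. g (b + s * j) - g' (b + s * j)) = g (b + s * k)"
proof (induction k)
  case 0
  show ?case using assms(2) by (cases "b < s") auto
next
  case (Suc k)
  thus ?case using assms(1) by simp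
qed

text \<open>\<open>\<phi>\<close> labels lines in direction \<open>s\<close>. A large level is
  reached along its line from a place where \<open>g'\<close> vanishes, so the line carries
  variation at least \<open>t\<close>. Different labels use disjoint indices, and
  \<open>sum_variation\<close> bounds the total.\<close>

lemma card_image_large_levels:
  fixes \<phi> :: "nat \<Rightarrow> 'b"
  assumes "s > 0" and S: "S \<subseteq> {..<n+s}" and large: "\<And>i. i \<in> S \<Longrightarrow> t \<le> g i"
    and chain: "\<And>i. i \<in> S \<Longrightarrow> \<exists>b k. i = b + s * k \<and> g' b = 0 \<and> (\<forall>j\<le>k. \<phi> (b + s * j) = \<phi> i)"
  shows "t * card (\<phi> ` S) \<le> 2 * ln K"
proof -
  define D where "D i = \<bar>g i - g' i\<bar>" for i
  have *: "t \<le> (\<Sum>i | i \<in> {..<n+s} \<and> \<phi> i = r. D i)" if "r \<in> \<phi> ` S" for r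
  proof -
    obtain i where i: "i \<in> S" "\<phi> i = r" using \<open>r \<in> \<phi> ` S\<close> by auto
    obtain b k where bk: "i = b + s * k" "g' b = 0" "\<And>j. j \<le> k \<Longrightarrow> \<phi> (b + s * j) = \<phi> i"
      using chain[OF i(1)] by blast
    have le: "b + s * j \<le> i" if "j \<le> k" for j using that bk(1) by simp
    have iN: "i < n + s" using i(1) S by auto
    have inj: "inj_on (\<lambda>j. b + s * j) {..k}" using \<open>s > 0\<close> by (auto simp: inj_on_def)
    have "t \<le> g i" by (rule large[OF i(1)])
    also have "\<dots> = (\<Sum>j\<le>k. g (b + s * j) - g' (b + s * j))"
      unfolding bk(1) by (rule sum_increments[OF \<open>s > 0\<close> bk(2), symmetric])
    also have "\<dots> \<le> (\<Sum>j\<le>k. D (b + s * j))" unfolding D_def by (intro sum_mono abs_ge_self)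
    also have "\<dots> = (\<Sum>i\<in>(\<lambda>j. b + s * j) ` {..k}. D i)" by (simp add: sum.reindex[OF inj])
    also have "\<dots> \<le> (\<Sum>i | i \<in> {..<n+s} \<and> \<phi> i = r. D i)"
      by (intro sum_mono2) (use bk(3) i(2) le iN in \<open>auto simp: D_def intro: le_less_trans\<close>)
    finally show ?thesis .
  qed
  have fS: "finite S" using S finite_subset by blast
  have "t * card (\<phi> ` S) = (\<Sum>r\<in>\<phi> ` S. t)" by simp
  also have "\<dots> \<le> (\<Sum>r\<in>\<phi> ` S. \<Sum>i | i \<in> {..<n+s} \<and> \<phi> i = r. D i)" by (intro sum_mono *)
  also have "\<dots> \<le> (\<Sum>r\<in>\<phi> ` {..<n+s}. \<Sum>i | i \<in> {..<n+s} \<and> \<phi> i = r. D i)"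
    using S by (intro sum_mono2) (auto simp: D_def intro: sum_nonneg)
  also have "\<dots> = (\<Sum>i<n+s. D i)" by (intro sum.group) auto
  also have "\<dots> \<le> 2 * ln K" unfolding D_def by (rule sum_variation)
  finally show ?thesis .
qed

end

text \<open>
  Index \<open>i + M * j + M\<^sup>2 * k\<close> with \<open>i, j < M\<close> is the point \<open>(i, j)\<close> of the grid number \<open>k\<close>. The last
  row and the last column of every grid are empty, so translations do not leak into another grid.
\<close>

lemma ln_card_le_grid:
  fixes A :: "'a::{finite,idom} poly set"
  assumes 1: "small_dilate A 1 n K\<^sub>1" and 2: "small_dilate A M n K\<^sub>2" and M: "M > 0"
    and K: "K\<^sub>1 \<ge> 2" "K\<^sub>2 \<ge> 2"
    and bd1: "\<And>f i. f \<in> A \<Longrightarrow> i mod M = M - 1 \<Longrightarrow> coeff f i = 0"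
    and bd2: "\<And>f i. f \<in> A \<Longrightarrow> i div M mod M = M - 1 \<Longrightarrow> coeff f i = 0"
  shows "ln (card A) \<le> (8 / ln 2 + 4 * ln CARD('a) / (exp (-16) / 16)\<^sup>2) * (ln K\<^sub>1 * ln K\<^sub>2)"
proof -
  interpret A: small_dilate A 1 n K\<^sub>1 by (rule 1)
  interpret B: small_dilate A M n K\<^sub>2 by (rule 2)
  let ?g = "\<lambda>i. level_entropy i A"
  define \<tau> :: real where "\<tau> = exp (-16) / 16"
  have \<tau>: "\<tau> > 0" by (simp add: \<tau>_def)
  define S where "S = {i. i < n \<and> \<tau> < ?g i}"
  define L where "L = ln (real CARD('a))"
  have L: "0 \<le> L" by (simp add: L_def Suc_leI)
  have z1: "?g i = 0" if "i mod M = M - 1" for i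
    using that bd1 A.fin A.ne by (intro level_entropy_eq_0)
  have z2: "?g i = 0" if "i div M mod M = M - 1" for i
    using that bd2 A.fin A.ne by (intro level_entropy_eq_0)
  have pred: "(M * r - 1) mod M = M - 1" if "r > 0" for r
  proof -
    have "M * r - 1 = M * (r - 1) + (M - 1)" using that M by (cases r) (auto simp: algebra_simps)
    moreover have "(M * (r - 1) + (M - 1)) mod M = (M - 1) mod M" by (rule mod_mult_self4)
    moreover have "(M - 1) mod M = M - 1" using M by (intro mod_less) simp
    ultimately show ?thesis by (simp only:)
  qed
  \<comment> \<open>A row fixes the second digit and the grid number, a column the first digit and
    the grid number.\<close>
  let ?row = "\<lambda>i. i div M" and ?col = "\<lambda>i. (i mod M, i div M div M)"
  have rows: "\<tau> * card (?row ` S) \<le> 2 * ln K\<^sub>1"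
  proof (rule A.card_image_large_levels)
    fix i assume "i \<in> S"
    show "\<exists>b k. i = b + 1 * k \<and> (if b < 1 then 0 else ?g (b - 1)) = 0 \<and>
      (\<forall>j\<le>k. (b + 1 * j) div M = i div M)"
    proof (intro exI conjI allI impI)
      \<comment> \<open>The chain starts where the row starts. The index before it, if any, has
        first digit \<open>M - 1\<close>, where the levels vanish.\<close>
      show "i = M * (i div M) + 1 * (i mod M)" by simp
      show "(if M * (i div M) < 1 then 0 else ?g (M * (i div M) - 1)) = 0"
        using z1[OF pred[of "i div M"]] by auto
      fix j assume "j \<le> i mod M"
      hence "j < M" using M by (meson le_less_trans mod_less_divisor)
      thus "(M * (i div M) + 1 * j) div M = i div M" using M by simp
    qed
  qed (auto simp: S_def)
  have cols: "\<tau> * card (?col ` S) \<le> 2 * ln K\<^sub>2"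
  proof (rule B.card_image_large_levels)
    fix i assume "i \<in> S"
    \<comment> \<open>\<open>?b\<close> is the point of the same column with second digit 0. A step
      of \<open>M\<close> backwards, if possible, leads to the previous grid at second digit
      \<open>M - 1\<close>, where the levels vanish.\<close>
    let ?b = "i mod M + M * (M * (i div M div M))"
    show "\<exists>b k. i = b + M * k \<and> (if b < M then 0 else ?g (b - M)) = 0 \<and>
      (\<forall>j\<le>k. ?col (b + M * j) = ?col i)"
    proof (intro exI conjI allI impI)
      have "i div M = M * (i div M div M) + i div M mod M" by simp
      hence "M * (i div M) = M * (M * (i div M div M)) + M * (i div M mod M)"
        by (metis distrib_left)
      thus "i = ?b + M * (i div M mod M)" using mod_mult_div_eq[of i M] by linarith
      have "?g (?b - M) = 0" if "\<not> ?b < M"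
      proof (rule z2)
        have pos: "i div M div M > 0" using that M by (cases "i div M div M = 0") auto
        hence "M * (i div M div M) \<ge> 1" using M by (simp add: Suc_leI)
        hence "?b - M = i mod M + M * (M * (i div M div M) - 1)"
          by (simp add: right_diff_distrib')
        hence "(?b - M) div M = M * (i div M div M) - 1" using M by simp
        thus "(?b - M) div M mod M = M - 1" using pred[OF pos] by simp
      qed
      thus "(if ?b < M then 0 else ?g (?b - M)) = 0" by auto
      fix j assume "j \<le> i div M mod M"
      hence j: "j < M" using M by (meson le_less_trans mod_less_divisor)
      have e: "?b + M * j = i mod M + M * (j + M * (i div M div M))" by (simp add: algebra_simps)
      have "(?b + M * j) div M = j + M * (i div M div M)" "(?b + M * j) mod M = i mod M"
        unfolding e using M by simp_all
      thus "?col (?b + M * j) = ?col i" using M j by simp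
    qed
  qed (use M in \<open>auto simp: S_def\<close>)
  \<comment> \<open>A row and a column determine the index, so the number of large levels is at most
    the product of the two counts.\<close>
  have "inj_on (\<lambda>i. (?row i, ?col i)) S"
    by (rule inj_onI) (metis div_mod_decomp prod.inject)
  hence "card S = card ((\<lambda>i. (?row i, ?col i)) ` S)" by (simp add: card_image)
  also have "\<dots> \<le> card (?row ` S \<times> ?col ` S)"
    by (intro card_mono) (auto simp: S_def)
  also have "\<dots> = card (?row ` S) * card (?col ` S)" by (rule card_cartesian_product)
  finally have "real (card S) \<le> real (card (?row ` S)) * real (card (?col ` S))"
    by (simp flip: of_nat_mult)
  also have "\<dots> \<le> (2 * ln K\<^sub>1 / \<tau>) * (2 * ln K\<^sub>2 / \<tau>)"
    using rows cols \<tau> K by (intro mult_mono) (auto simp: field_simps)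
  finally have S: "real (card S) \<le> 4 / \<tau>\<^sup>2 * (ln K\<^sub>1 * ln K\<^sub>2)" by (simp add: power2_eq_square)
  have "(\<Sum>i\<in>S. ?g i) \<le> (\<Sum>i\<in>S. L)"
    unfolding L_def using A.fin A.ne by (intro sum_mono level_entropy_le)
  also have "\<dots> = card S * L" by simp
  also have "\<dots> \<le> 4 / \<tau>\<^sup>2 * (ln K\<^sub>1 * ln K\<^sub>2) * L" using S L by (rule mult_right_mono)
  finally have big: "(\<Sum>i\<in>S. ?g i) \<le> 4 * L / \<tau>\<^sup>2 * (ln K\<^sub>1 * ln K\<^sub>2)" by (simp add: mult_ac)
  have "(\<Sum>i\<in>{..<n} - S. ?g i) \<le> 8 * ln K\<^sub>1"
    by (rule A.sum_small_levels) (auto simp: S_def \<tau>_def)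
  \<comment> \<open>The bound \<open>K\<^sub>2 >= 2\<close> turns the single logarithm into a
    product of two.\<close>
  also have "\<dots> = 8 / ln 2 * (ln K\<^sub>1 * ln 2)" by simp
  also have "\<dots> \<le> 8 / ln 2 * (ln K\<^sub>1 * ln K\<^sub>2)" using K by (intro mult_left_mono) auto
  finally have small: "(\<Sum>i\<in>{..<n} - S. ?g i) \<le> 8 / ln 2 * (ln K\<^sub>1 * ln K\<^sub>2)" .
  have "ln (card A) = (\<Sum>i<n. ?g i)"
    using A.fin A.ne A.deg by (intro ln_card_eq_sum_level_entropy)
  also have "\<dots> = (\<Sum>i\<in>{..<n} - S. ?g i) + (\<Sum>i\<in>S. ?g i)"
    by (rule sum.subset_diff) (auto simp: S_def)
  also have "\<dots> \<le> 8 / ln 2 * (ln K\<^sub>1 * ln K\<^sub>2) + 4 * L / \<tau>\<^sup>2 * (ln K\<^sub>1 * ln K\<^sub>2)"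
    using small big by (rule add_mono)
  finally show ?thesis unfolding L_def \<tau>_def by (simp only: distrib_right)
qed

subsection \<open>Reduction to polynomials\<close>

lemma coeff_poly_monom:
  fixes Q :: "'a::comm_ring_1 poly poly"
  assumes "M > 0" "\<And>k i. M \<le> i \<Longrightarrow> coeff (coeff Q k) i = 0"
  shows "coeff (poly Q (monom 1 M)) n = coeff (coeff Q (n div M)) (n mod M)"
  using assms(2)
proof (induction Q arbitrary: n)
  case 0
  then show ?case by simp
next
  case (pCons q Q)
  have IH: "coeff (poly Q (monom 1 M)) m = coeff (coeff Q (m div M)) (m mod M)" for m
  proof (rule pCons.IH)
    fix k i assume "M \<le> i"
    thus "coeff (coeff Q k) i = 0" using pCons.prems[of i "Suc k"] by simp
  qed
  show ?case
  proof (cases "n < M")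
    case True
    then show ?thesis by (simp add: coeff_monom_mult)
  next
    case False
    then have "coeff q n = 0" using pCons.prems[of n 0] by simp
    moreover have "n div M = Suc ((n - M) div M)" "n mod M = (n - M) mod M"
      using False assms(1) by (simp_all add: le_div_geq le_mod_geq)
    ultimately show ?thesis using False by (simp add: coeff_monom_mult IH)
  qed
qed

text \<open>The outermost variable becomes the \<open>M\<close>-th power of the middle one, which
  then becomes \<open>z ^ M\<close>. From the inside out the three variables go to \<open>z\<close>,
  \<open>z ^ M\<close> and \<open>z ^ (M ^ 2)\<close>, so exponents become digits in base
  \<open>M\<close>.\<close>

definition kronecker :: "nat \<Rightarrow> 'a::comm_ring_1 poly poly poly \<Rightarrow> 'a poly" where
  "kronecker M Q = poly (poly Q (monom 1 M)) (monom 1 M)"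

lemma kronecker_add: "kronecker M (P + Q) = kronecker M P + kronecker M Q"
  by (simp add: kronecker_def)

lemma kronecker_mult: "kronecker M (P * Q) = kronecker M P * kronecker M Q"
  by (simp add: kronecker_def)

lemma coeff_kronecker:
  assumes "M > 0" "\<And>k j i. M \<le> i \<or> M \<le> j \<Longrightarrow> coeff (coeff (coeff Q k) j) i = 0"
  shows "coeff (kronecker M Q) n = coeff (coeff (coeff Q (n div M div M)) (n div M mod M)) (n mod M)"
proof -
  have *: "coeff (poly Q (monom 1 M)) m = coeff (coeff Q (m div M)) (m mod M)" for m
    using assms by (intro coeff_poly_monom) (auto simp: poly_eq_iff)
  have "coeff (kronecker M Q) n = coeff (coeff (poly Q (monom 1 M)) (n div M)) (n mod M)"
    unfolding kronecker_def using assms by (intro coeff_poly_monom) (auto simp: *)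
  thus ?thesis by (simp add: *)
qed

text \<open>With both inner exponents below \<open>M\<close> the blocks of coefficients do not
  overlap, and each coefficient can be read off at index \<open>i + M * (j + M * k)\<close>.\<close>

lemma kronecker_inject:
  assumes "M > 0" "\<And>k j i. M \<le> i \<or> M \<le> j \<Longrightarrow> coeff (coeff (coeff P k) j) i = 0"
    and "\<And>k j i. M \<le> i \<or> M \<le> j \<Longrightarrow> coeff (coeff (coeff Q k) j) i = 0"
    and eq: "kronecker M P = kronecker M Q"
  shows "P = Q"
proof -
  have "coeff (coeff (coeff P k) j) i = coeff (coeff (coeff Q k) j) i" for k j i
  proof (cases "i < M \<and> j < M")
    case True
    define n where "n = i + M * (j + M * k)"
    have "n mod M = i" "n div M = j + M * k" using True by (simp_all add: n_def)
    moreover from this have "n div M mod M = j" "n div M div M = k" using True by simp_all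
    ultimately show ?thesis
      using coeff_kronecker[OF assms(1,2), of n] coeff_kronecker[OF assms(1,3), of n] eq by simp
  next
    case False
    hence "M \<le> i \<or> M \<le> j" by linarith
    thus ?thesis using assms(2,3) by metis
  qed
  thus ?thesis by (simp add: poly_eq_iff)
qed

lemma eventually_coeff_eq_0_2:
  fixes P :: "'a::zero poly poly"
  shows "\<exists>m. \<forall>j i. m \<le> i \<or> m \<le> j \<longrightarrow> coeff (coeff P j) i = 0"
proof (induction P)
  case 0
  then show ?case by simp
next
  case (pCons q P)
  then obtain m where m: "\<And>j i. m \<le> i \<or> m \<le> j \<Longrightarrow> coeff (coeff P j) i = 0" by blast
  have "coeff (coeff (pCons q P) j) i = 0"
    if "max (Suc m) (Suc (degree q)) \<le> i \<or> max (Suc m) (Suc (degree q)) \<le> j" for i j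
  proof (cases j)
    case 0
    thus ?thesis using that by (auto simp: coeff_eq_0)
  next
    case (Suc j')
    hence "m \<le> i \<or> m \<le> j'" using that by linarith
    thus ?thesis using m Suc by simp
  qed
  thus ?case by blast
qed

text \<open>The eventual form lets one bound serve finitely many polynomials at once.\<close>

lemma eventually_coeff_eq_0_3:
  fixes Q :: "'a::zero poly poly poly"
  shows "\<forall>\<^sub>F m in sequentially. \<forall>k j i. m \<le> i \<or> m \<le> j \<longrightarrow> coeff (coeff (coeff Q k) j) i = 0"
proof (induction Q)
  case 0
  then show ?case by simp
next
  case (pCons P Q)
  obtain m where m: "\<And>j i. m \<le> i \<or> m \<le> j \<Longrightarrow> coeff (coeff P j) i = 0"
    using eventually_coeff_eq_0_2[of P] by blast
  show ?case
    using pCons.IH eventually_ge_at_top[of m]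
  proof eventually_elim
    case (elim m')
    show ?case
    proof (intro allI impI)
      fix k j i assume "m' \<le> i \<or> m' \<le> j"
      thus "coeff (coeff (coeff (pCons P Q) k) j) i = 0"
        using elim m by (cases k) (auto dest: order_trans)
    qed
  qed
qed

text \<open>The polynomial \<open>Q\<close> only serves as a finite sequence of coefficients.\<close>

definition lin_comb :: "('r::zero \<Rightarrow> 'f::comm_ring_1) \<Rightarrow> nat \<Rightarrow> (nat \<Rightarrow> 'f) \<Rightarrow> 'r poly \<Rightarrow> 'f" where
  "lin_comb h d b Q = (\<Sum>k<d. h (coeff Q k) * b k)"

text \<open>Linear algebra without fractions: members of \<open>A\<close> are adjoined greedily to
  an independent family, and \<open>r\<close> is a common denominator of the coordinates.\<close>

lemma exists_basis_up_to_multiple: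
  fixes h :: "'r::idom \<Rightarrow> 'f::idom"
  assumes hom: "comm_ring_hom h" and fin: "finite A"
  shows "\<exists>d b r. r \<noteq> 0 \<and>
    (\<forall>Q. (\<forall>k\<ge>d. coeff Q k = 0) \<longrightarrow> lin_comb h d b Q = 0 \<longrightarrow> Q = 0) \<and>
    (\<forall>a\<in>A. \<exists>Q. (\<forall>k\<ge>d. coeff Q k = 0) \<and> h r * a = lin_comb h d b Q)"
  using fin
proof induction
  case empty
  have "(1::'r) \<noteq> 0 \<and> (\<forall>Q :: 'r poly. (\<forall>k\<ge>0. coeff Q k = 0) \<longrightarrow> lin_comb h 0 (\<lambda>_. 0) Q = 0 \<longrightarrow> Q = 0)"
    by (simp add: poly_eq_iff)
  thus ?case by blast
next
  case (insert a A)
  interpret hom: comm_ring_hom h by (rule hom)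
  obtain d b r where r: "r \<noteq> 0"
    and indep: "\<And>Q. \<forall>k\<ge>d. coeff Q k = 0 \<Longrightarrow> lin_comb h d b Q = 0 \<Longrightarrow> Q = 0"
    and span: "\<And>a. a \<in> A \<Longrightarrow> \<exists>Q. (\<forall>k\<ge>d. coeff Q k = 0) \<and> h r * a = lin_comb h d b Q"
    using insert.IH by blast
  have smult: "lin_comb h d b (smult c Q) = h c * lin_comb h d b Q" for d b c Q
    by (simp add: lin_comb_def sum_distrib_left hom.hom_mult mult.assoc)
  show ?case
  \<comment> \<open>Either some nonzero multiple of \<open>a\<close> lies in the span already, and
    its denominator joins \<open>r\<close>, or \<open>a\<close> becomes a new member of the
    family.\<close>
  proof (cases "\<exists>s Q. s \<noteq> 0 \<and> (\<forall>k\<ge>d. coeff Q k = 0) \<and> h s * a = lin_comb h d b Q")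
    case True
    then obtain s P where s: "s \<noteq> 0" "\<forall>k\<ge>d. coeff P k = 0" "h s * a = lin_comb h d b P"
      by blast
    have "\<exists>Q. (\<forall>k\<ge>d. coeff Q k = 0) \<and> h (r * s) * x = lin_comb h d b Q"
      if "x \<in> insert a A" for x
    proof (cases "x = a")
      case True
      have "h (r * s) * x = lin_comb h d b (smult r P)"
        using s(3) True by (simp add: smult hom.hom_mult mult.assoc)
      thus ?thesis using s(2) by (intro exI[of _ "smult r P"]) simp
    next
      case False
      then obtain Q where Q: "\<forall>k\<ge>d. coeff Q k = 0" "h r * x = lin_comb h d b Q"
        using span \<open>x \<in> insert a A\<close> by blast
      have "h (r * s) * x = lin_comb h d b (smult s Q)"
        using Q(2)[symmetric] by (simp add: smult hom.hom_mult mult_ac)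
      thus ?thesis using Q(1) by (intro exI[of _ "smult s Q"]) simp
    qed
    moreover have "r * s \<noteq> 0" using r s by simp
    ultimately show ?thesis using indep by blast
  next
    case False
    define b' where "b' = b(d := a)"
    have Suc: "lin_comb h (Suc d) b' Q = lin_comb h d b Q + h (coeff Q d) * a" for Q
      by (simp add: lin_comb_def b'_def)
    have "Q = 0" if bd: "\<forall>k\<ge>Suc d. coeff Q k = 0" and 0: "lin_comb h (Suc d) b' Q = 0" for Q
    proof -
      have bd': "coeff Q k = 0" if "d < k" for k using bd that by simp
      \<comment> \<open>\<open>P\<close> carries the terms of index below \<open>d\<close> to the
        other side: a relation with nonzero coefficient at \<open>d\<close> would put a nonzero
        multiple of \<open>a\<close> in the span.\<close>
      define P where "P = monom (coeff Q d) d - Q"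
      have P: "\<forall>k\<ge>d. coeff P k = 0"
        using bd' by (auto simp: P_def le_less)
      have "lin_comb h d b P = (\<Sum>k<d. - (h (coeff Q k) * b k))"
        unfolding lin_comb_def by (intro sum.cong) (auto simp: P_def hom.hom_uminus)
      also have "\<dots> = - lin_comb h d b Q" by (simp add: lin_comb_def sum_negf)
      also have "\<dots> = h (coeff Q d) * a" using 0 by (simp add: Suc neg_eq_iff_add_eq_0)
      finally have "coeff Q d = 0" using False P by metis
      hence "\<forall>k\<ge>d. coeff Q k = 0" "lin_comb h d b Q = 0"
        using bd' 0 by (auto simp: Suc le_less)
      thus ?thesis by (rule indep)
    qed
    moreover have "\<exists>Q. (\<forall>k\<ge>Suc d. coeff Q k = 0) \<and> h r * x = lin_comb h (Suc d) b' Q"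
      if "x \<in> insert a A" for x
    proof (cases "x = a")
      case True
      have "lin_comb h d b (monom r d) = 0" by (simp add: lin_comb_def)
      thus ?thesis using True by (intro exI[of _ "monom r d"]) (simp add: Suc)
    next
      case False
      then obtain Q where Q: "\<forall>k\<ge>d. coeff Q k = 0" "h r * x = lin_comb h d b Q"
        using span \<open>x \<in> insert a A\<close> by blast
      thus ?thesis by (intro exI[of _ Q]) (simp add: Suc)
    qed
    ultimately show ?thesis using r by blast
  qed
qed

section \<open>The polynomial model of the set\<close>

lemma comm_ring_hom_poly_map_poly:
  fixes h :: "'a::comm_ring_1 \<Rightarrow> 'b::comm_ring_1"
  assumes "comm_ring_hom h"
  shows "comm_ring_hom (\<lambda>p. poly (map_poly h p) x)"
proof -
  interpret map_poly_comm_ring_hom h using assms by (simp add: map_poly_comm_ring_hom_def)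
  show ?thesis by unfold_locales (auto simp: hom_add hom_mult)
qed

lemma comm_ring_hom_eval_bivariate: "comm_ring_hom (\<lambda>P. eval_bivariate P x y)"
proof -
  have "comm_ring_hom (fls_const :: 'a \<Rightarrow> 'a fls)"
    by unfold_locales (auto simp: fls_const_mult_const fls_plus_const)
  thus ?thesis unfolding eval_bivariate_def by (intro comm_ring_hom_poly_map_poly)
qed

lemma eval_bivariate_var:
  "eval_bivariate [:[:0, 1:]:] x y = x"
  "eval_bivariate [:0, 1:] x y = y"
  by (simp_all add: eval_bivariate_def map_poly_pCons)

text \<open>Algebraic independence makes evaluation injective, so the elements
  \<open>ev r * a\<close> have unique polynomial coordinates, on which \<open>\<xi>\<^sub>1\<close>
  and \<open>\<xi>\<^sub>2\<close> act as the two variables. The index of the basis element is the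
  exponent of a third variable, and Kronecker substitution merges all three.\<close>

lemma exists_polynomial_model:
  fixes A :: "'a::field fls set"
  assumes fin: "finite A" and ne: "A \<noteq> {}" and ai: "algebraically_independent \<xi>\<^sub>1 \<xi>\<^sub>2"
  obtains B :: "'a poly set" and M n where "finite B" "card B = card A" "M > 0"
    "\<And>f i. f \<in> B \<Longrightarrow> n \<le> i \<Longrightarrow> coeff f i = 0"
    "\<And>f i. f \<in> B \<Longrightarrow> i mod M = M - 1 \<Longrightarrow> coeff f i = 0"
    "\<And>f i. f \<in> B \<Longrightarrow> i div M mod M = M - 1 \<Longrightarrow> coeff f i = 0"
    "card (sumset B ((*) (monom 1 1) ` B)) \<le> card (sum_dilate A \<xi>\<^sub>1)"
    "card (sumset B ((*) (monom 1 M) ` B)) \<le> card (sum_dilate A \<xi>\<^sub>2)"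
proof -
  define ev where "ev = (\<lambda>P. eval_bivariate P \<xi>\<^sub>1 \<xi>\<^sub>2)"
  have hom: "comm_ring_hom ev" unfolding ev_def by (rule comm_ring_hom_eval_bivariate)
  interpret ev: comm_ring_hom ev by (rule hom)
  have inj: "P = 0" if "ev P = 0" for P
    using ai that unfolding algebraically_independent_def ev_def by blast
  obtain d b r where basis: "r \<noteq> 0 \<and>
      (\<forall>Q. (\<forall>k\<ge>d. coeff Q k = 0) \<longrightarrow> lin_comb ev d b Q = 0 \<longrightarrow> Q = 0) \<and>
      (\<forall>a\<in>A. \<exists>Q. (\<forall>k\<ge>d. coeff Q k = 0) \<and> ev r * a = lin_comb ev d b Q)"
    using exists_basis_up_to_multiple[OF hom fin] by (elim exE)
  note r = basis[THEN conjunct1]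
    and indep = basis[THEN conjunct2, THEN conjunct1, rule_format]
    and span = basis[THEN conjunct2, THEN conjunct2]
  have er: "ev r \<noteq> 0" using r inj by blast
  obtain q where q': "\<forall>a\<in>A. (\<forall>k\<ge>d. coeff (q a) k = 0) \<and> ev r * a = lin_comb ev d b (q a)"
    using bchoice[OF span] by (elim exE)
  have q: "coeff (q a) k = 0" if "a \<in> A" "d \<le> k" for a k using q' that by blast
  have eq: "lin_comb ev d b (q a) = ev r * a" if "a \<in> A" for a using q' that by simp
  have "\<forall>\<^sub>F m in sequentially. \<forall>a\<in>A. \<forall>k j i. m \<le> i \<or> m \<le> j \<longrightarrow> coeff (coeff (coeff (q a) k) j) i = 0"
    using fin by (intro eventually_ball_finite ballI eventually_coeff_eq_0_3)
  then obtain m where m: "\<And>a k j i. a \<in> A \<Longrightarrow> m \<le> i \<or> m \<le> j \<Longrightarrow> coeff (coeff (coeff (q a) k) j) i = 0"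
    unfolding eventually_sequentially by blast
  \<comment> \<open>The extra 1 keeps the digit \<open>M - 1\<close> free in both inner
    positions.\<close>
  define M where "M = Suc m"
  define \<psi> where "\<psi> a = kronecker M (q a)" for a
  have M: "M > 0" by (simp add: M_def)
  have bd: "coeff (coeff (coeff (q a) k) j) i = 0" if "a \<in> A" "M \<le> i \<or> M \<le> j" for a k j i
    using that m[of a i j k] by (auto simp: M_def)
  have coeff_\<psi>: "coeff (\<psi> a) i = coeff (coeff (coeff (q a) (i div M div M)) (i div M mod M)) (i mod M)"
    if "a \<in> A" for a i
    unfolding \<psi>_def using bd[OF that] by (intro coeff_kronecker M)
  have "inj_on \<psi> A"
  proof (rule inj_onI)
    fix a a' assume a: "a \<in> A" "a' \<in> A" "\<psi> a = \<psi> a'"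
    have "q a = q a'"
      using a(3) bd[OF a(1)] bd[OF a(2)] unfolding \<psi>_def by (rule kronecker_inject[OF M, rotated 2])
    hence "ev r * a = ev r * a'" using eq[OF a(1)] eq[OF a(2)] by metis
    thus "a = a'" using er by simp
  qed
  hence card: "card (\<psi> ` A) = card A" by (rule card_image)
  have lin: "lin_comb ev d b (P + smult \<zeta> Q) = lin_comb ev d b P + ev \<zeta> * lin_comb ev d b Q" for P Q \<zeta>
    by (simp add: lin_comb_def ev.hom_add ev.hom_mult sum.distrib sum_distrib_left distrib_right mult.assoc)
  have lin_diff: "lin_comb ev d b (P - Q) = lin_comb ev d b P - lin_comb ev d b Q" for P Q
    using lin[of P "-1" Q] by (simp add: ev.hom_uminus)
  have sums: "card (sumset (\<psi> ` A) ((*) (monom 1 s) ` \<psi> ` A)) \<le> card (sum_dilate A (ev \<zeta>))"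
    if \<zeta>: "kronecker M [:\<zeta>:] = monom 1 s" for \<zeta> s
  proof -
    \<comment> \<open>\<open>W\<close> holds the coordinates of the elements
      \<open>ev r * (a + ev \<zeta> * c)\<close>. Independence makes it no larger than the sum of
      dilates, and its image under \<open>kronecker M\<close> contains the sumset.\<close>
    define W where "W = {q a + smult \<zeta> (q c) | a c. a \<in> A \<and> c \<in> A}"
    have fW: "finite W" unfolding W_def using fin by (intro finite_image_set2) auto
    have injW: "inj_on (lin_comb ev d b) W"
    proof (rule inj_onI)
      fix P Q assume PQ: "P \<in> W" "Q \<in> W" "lin_comb ev d b P = lin_comb ev d b Q"
      have "P - Q = 0"
        using PQ q by (intro indep) (auto simp: W_def lin_diff)
      thus "P = Q" by simp
    qed
    have "sumset (\<psi> ` A) ((*) (monom 1 s) ` \<psi> ` A) \<subseteq> kronecker M ` W"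
    proof
      fix x assume "x \<in> sumset (\<psi> ` A) ((*) (monom 1 s) ` \<psi> ` A)"
      then obtain a c where ac: "a \<in> A" "c \<in> A" "x = \<psi> a + monom 1 s * \<psi> c"
        by (auto simp: sumset_def)
      have "x = kronecker M (q a + smult \<zeta> (q c))"
        unfolding ac(3) \<psi>_def \<zeta>[symmetric] by (simp add: kronecker_add flip: kronecker_mult)
      thus "x \<in> kronecker M ` W" using ac by (auto simp: W_def)
    qed
    hence "card (sumset (\<psi> ` A) ((*) (monom 1 s) ` \<psi> ` A)) \<le> card W"
      using fW by (meson card_image_le card_mono finite_imageI order_trans)
    also have "\<dots> = card (lin_comb ev d b ` W)" using injW by (rule card_image[symmetric])
    also have "\<dots> \<le> card ((*) (ev r) ` sum_dilate A (ev \<zeta>))"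
    proof (rule card_mono)
      show "finite ((*) (ev r) ` sum_dilate A (ev \<zeta>))"
        unfolding sum_dilate_def using fin by (intro finite_imageI finite_image_set2) auto
      show "lin_comb ev d b ` W \<subseteq> (*) (ev r) ` sum_dilate A (ev \<zeta>)"
      proof
        fix x assume "x \<in> lin_comb ev d b ` W"
        then obtain a c where ac: "a \<in> A" "c \<in> A" "x = lin_comb ev d b (q a + smult \<zeta> (q c))"
          by (auto simp: W_def)
        have "x = ev r * (a + ev \<zeta> * c)" using ac by (simp add: lin eq algebra_simps)
        thus "x \<in> (*) (ev r) ` sum_dilate A (ev \<zeta>)" using ac by (auto simp: sum_dilate_def)
      qed
    qed
    also have "\<dots> \<le> card (sum_dilate A (ev \<zeta>))"
      unfolding sum_dilate_def using fin by (intro card_image_le finite_image_set2) auto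
    finally show ?thesis .
  qed
  define n where "n = Suc (Max (degree ` \<psi> ` A))"
  have deg: "coeff f i = 0" if "f \<in> \<psi> ` A" "n \<le> i" for f i
  proof (rule coeff_eq_0)
    have "degree f \<le> Max (degree ` \<psi> ` A)" using fin that(1) by (intro Max_ge) auto
    thus "degree f < i" using that(2) by (simp add: n_def)
  qed
  show ?thesis
  proof (rule that[of "\<psi> ` A" M n])
    show "card (sumset (\<psi> ` A) ((*) (monom 1 1) ` \<psi> ` A)) \<le> card (sum_dilate A \<xi>\<^sub>1)"
      using sums[of "[:[:0, 1:]:]" 1] by (simp add: ev_def eval_bivariate_var kronecker_def monom_Suc)
    show "card (sumset (\<psi> ` A) ((*) (monom 1 M) ` \<psi> ` A)) \<le> card (sum_dilate A \<xi>\<^sub>2)"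
      using sums[of "[:0, 1:]" M] by (simp add: ev_def eval_bivariate_var kronecker_def)
    show "coeff f i = 0" if "f \<in> \<psi> ` A" "i mod M = M - 1" for f i
      using that m by (auto simp: coeff_\<psi> M_def)
    show "coeff f i = 0" if "f \<in> \<psi> ` A" "i div M mod M = M - 1" for f i
      using that m by (auto simp: coeff_\<psi> M_def)
  qed (use fin card M deg in auto)
qed

theorem theorem6:
  shows "\<exists>c::real. c > 0 \<and>
    (\<forall>(A :: 'p::prime_card laurent_inv_t set) \<xi>\<^sub>1 \<xi>\<^sub>2 (K\<^sub>1::real) (K\<^sub>2::real).
      finite A \<longrightarrow>
      algebraically_independent \<xi>\<^sub>1 \<xi>\<^sub>2 \<longrightarrow>
      K\<^sub>1 \<ge> 2 \<longrightarrow> K\<^sub>2 \<ge> 2 \<longrightarrow>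
      real (card (sum_dilate A \<xi>\<^sub>1)) \<le> K\<^sub>1 * real (card A) \<longrightarrow>
      real (card (sum_dilate A \<xi>\<^sub>2)) \<le> K\<^sub>2 * real (card A) \<longrightarrow>
      ln K\<^sub>1 * ln K\<^sub>2 \<ge> c * ln (real (card A)))"
proof -
  define C :: real where "C = 8 / ln 2 + 4 * ln (real CARD('p mod_ring)) / (exp (-16) / 16)\<^sup>2"
  have C: "C > 0" unfolding C_def by (intro add_pos_nonneg) (auto simp: Suc_leI)
  show ?thesis
  proof (intro exI[of _ "1 / C"] conjI allI impI)
    show "1 / C > 0" using C by simp
    fix A :: "'p laurent_inv_t set" and \<xi>\<^sub>1 \<xi>\<^sub>2 and K\<^sub>1 K\<^sub>2 :: real
    assume fin: "finite A" and ai: "algebraically_independent \<xi>\<^sub>1 \<xi>\<^sub>2" and K: "K\<^sub>1 \<ge> 2" "K\<^sub>2 \<ge> 2"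
      and s1: "real (card (sum_dilate A \<xi>\<^sub>1)) \<le> K\<^sub>1 * real (card A)"
      and s2: "real (card (sum_dilate A \<xi>\<^sub>2)) \<le> K\<^sub>2 * real (card A)"
    show "1 / C * ln (real (card A)) \<le> ln K\<^sub>1 * ln K\<^sub>2"
    proof (cases "A = {}")
      \<comment> \<open>The empty set is covered by the convention \<open>ln 0 = 0\<close>.\<close>
      case True
      thus ?thesis using K by simp
    next
      case False
      obtain B :: "'p mod_ring poly set" and M n where
        B: "finite B" "card B = card A" "M > 0"
        "\<And>f i. f \<in> B \<Longrightarrow> n \<le> i \<Longrightarrow> coeff f i = 0"
        "\<And>f i. f \<in> B \<Longrightarrow> i mod M = M - 1 \<Longrightarrow> coeff f i = 0"
        "\<And>f i. f \<in> B \<Longrightarrow> i div M mod M = M - 1 \<Longrightarrow> coeff f i = 0"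
        and c1: "card (sumset B ((*) (monom 1 1) ` B)) \<le> card (sum_dilate A \<xi>\<^sub>1)"
        and c2: "card (sumset B ((*) (monom 1 M) ` B)) \<le> card (sum_dilate A \<xi>\<^sub>2)"
        using exists_polynomial_model[OF fin False ai] by metis
      have ne: "B \<noteq> {}" using B(2) False fin by auto
      have "small_dilate B 1 n K\<^sub>1"
        by unfold_locales (use B ne c1 s1 in auto)
      moreover have "small_dilate B M n K\<^sub>2"
        by unfold_locales (use B ne c2 s2 in auto)
      ultimately have "ln (card B) \<le> C * (ln K\<^sub>1 * ln K\<^sub>2)"
        unfolding C_def using B K by (intro ln_card_le_grid)
      thus ?thesis using C B(2) by (simp add: field_simps)
    qed
  qed
qed

end
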